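(* For every integer $n\ge 1$, $|\mathcal{S}_n(23;\,1\to 2)| = B_n$, where $B_n$ is the $n$-th Bell number.
   Context: $[n]=\{1,\dots,n\}$, and $\mathcal{S}_n$ is the set of permutations $\pi=\pi_1\pi_2\cdots\pi_n$ of $[n]$ in one-line notation. The permutation $\hat\pi$: for $\pi\in\mathcal{S}_n$, $\hat\pi\in\mathcal{S}_n$ is the permutation whose cycle form is obtained from the word $\pi_1\cdots\pi_n$ by inserting a left parenthesis before each left-to-right maximum (an entry larger than all entries to its left) and a right parenthesis immediately before the next left-to-right maximum, or at the end of the word. A cycle $(c_1,c_2,\dots,c_s)$ means $c_1\mapsto c_2\mapsto\cdots\mapsto c_s\mapsto c_1$. Example: if $\pi=2537164$ then $\hat\pi=(2)(53)(7164)$. Arrow patterns: an arrow pattern of size $k$ is a pair $(\nu;H)$ where $\nu=\nu_1\cdots\nu_m$ is a word of distinct positive integers, $H$ is a collection of arrows $b_i\to c_i$, and the set of all integers appearing in $\nu$ or $H$ is $[k]$. A permutation $\pi\in\mathcal{S}_n$ contains $(\nu;H)$ if there are a set $X=\{x_1<x_2<\cdots<x_k\}\subseteq[n]$ and indices $t_1<\cdots<t_m$ such that $\pi_{t_1}\pi_{t_2}\cdots\pi_{t_m}=x_{\nu_1}x_{\nu_2}\cdots x_{\nu_m}$ and $\hat\pi(x_{b_i})=x_{c_i}$ for every arrow $b_i\to c_i$ in $H$. Otherwise $\pi$ avoids $(\nu;H)$. $\mathcal{S}_n(\nu;H)$ is the set of permutations in $\mathcal{S}_n$ avoiding $(\nu;H)$.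 The Bell number $B_n$ is the number of set partitions of $[n]$. *)

theory Defs
  imports
    "HOL-Combinatorics.Multiset_Permutations"
    "HOL-Combinatorics.Cycles"
    "HOL-Library.Disjoint_Sets"
begin

text \<open>Permutations of \<open>[n]\<close> in one-line notation are the lists in
  \<^term>\<open>permutations_of_set {1..n::nat}\<close>.\<close>

text \<open>A block starts at a left-to-right maximum \<open>x\<close>; since \<open>x\<close> exceeds all entries
  to its left, the next left-to-right maximum is the first later entry exceeding \<open>x\<close>.\<close>

function lrmax_blocks :: "nat list \<Rightarrow> nat list list" where
  "lrmax_blocks [] = []"
| "lrmax_blocks (x # xs) =
     (x # takeWhile (\<lambda>y. y \<le> x) xs) # lrmax_blocks (dropWhile (\<lambda>y. y \<le> x) xs)"
  by pat_completeness auto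
termination
  by (relation "measure length") (auto simp: le_imp_less_Suc length_dropWhile_le)

lemma "lrmax_blocks [2,5,3,7,1,6,4] = [[2], [5,3], [7,1,6,4]]"
  by simp

text \<open>\<^term>\<open>cycle_of_list [c\<^sub>1, c\<^sub>2, c\<^sub>3]\<close> maps \<open>c\<^sub>1\<close> to \<open>c\<^sub>2\<close>, \<open>c\<^sub>2\<close> to \<open>c\<^sub>3\<close>
  and \<open>c\<^sub>3\<close> to \<open>c\<^sub>1\<close>.\<close>

definition hat :: "nat list \<Rightarrow> nat \<Rightarrow> nat" where
  "hat p = foldr (\<circ>) (map cycle_of_list (lrmax_blocks p)) id"

lemma "map (hat [2,5,3,7,1,6,4]) [1,2,3,4,5,6,7] = [6,2,5,7,3,4,1]"
  by (simp add: hat_def transpose_def)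

text \<open>In \<open>(\<nu>, H)\<close>, a pair \<open>(b, c) \<in> H\<close> is the arrow \<open>b \<rightarrow> c\<close>.\<close>

type_synonym arrow_pattern = "nat list \<times> (nat \<times> nat) set"

definition letters :: "arrow_pattern \<Rightarrow> nat set" where
  "letters P = set (fst P) \<union> Field (snd P)"

definition pattern_size :: "arrow_pattern \<Rightarrow> nat" where
  "pattern_size P = card (letters P)"

definition is_arrow_pattern :: "arrow_pattern \<Rightarrow> bool" where
  "is_arrow_pattern P \<longleftrightarrow> distinct (fst P) \<and> letters P = {1..pattern_size P}"

lemma "is_arrow_pattern ([2,3], {(1,2)})" and "pattern_size ([2,3], {(1,2)}) = 3"
  by (auto simp: is_arrow_pattern_def pattern_size_def letters_def)

text \<open>The set \<open>X = {x\<^sub>1 < \<dots> < x\<^sub>k}\<close> is given by its increasing enumeration \<open>x\<close>.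
  Positions in the lists \<open>p\<close> and \<open>\<nu>\<close> are counted from \<open>0\<close>.\<close>

definition contains_arrow :: "nat list \<Rightarrow> arrow_pattern \<Rightarrow> bool" where
  "contains_arrow p P \<longleftrightarrow> (case P of (\<nu>, H) \<Rightarrow>
     \<exists>(x :: nat \<Rightarrow> nat) (t :: nat \<Rightarrow> nat).
       strict_mono_on {1..pattern_size P} x \<and> x ` {1..pattern_size P} \<subseteq> {1..length p} \<and>
       strict_mono_on {..<length \<nu>} t \<and> t ` {..<length \<nu>} \<subseteq> {..<length p} \<and>
       (\<forall>j < length \<nu>. p ! (t j) = x (\<nu> ! j)) \<and>
       (\<forall>(b, c) \<in> H. hat p (x b) = x c))"

definition avoiders :: "nat \<Rightarrow> arrow_pattern \<Rightarrow> nat list set" where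
  "avoiders n P = {p \<in> permutations_of_set {1..n}. \<not> contains_arrow p P}"

definition bell :: "nat \<Rightarrow> nat" where
  "bell n = card {Q. partition_on {1..n} Q}"

end

theory Submission
  imports Defs "HOL-Library.Sublist"
begin

text \<open>A cycle of \<open>hat p\<close> with at least two elements sends a smaller element to its
  head, so it must be the last one, or else the head of the next cycle plays the role of 3.
  Hence an avoider of \<open>[n]\<close> is an increasing word, then \<open>n\<close>, then a word avoiding the
  vincular pattern 12-3. Splitting words of the latter kind at their maximum shows that they
  satisfy the recurrence \<open>B(A \<union> {m}) = (\<Sum>S \<subseteq> A. B(S))\<close> of the Bell numbers, and
  the decomposition of the avoiders is one further instance of the same recurrence.\<close>

section \<open>A recurrence for set partitions\<close>

text \<open>Deleting the block of \<open>m\<close> leaves a partition of some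
  \<open>S \<subseteq> A\<close>, and the deleted block must have been
  \<open>insert m (A - S)\<close>, so nothing is lost.\<close>

lemma card_partition_on_insert:
  assumes "finite A" "m \<notin> A"
  shows "card {Q. partition_on (insert m A) Q} = (\<Sum>S\<in>Pow A. card {Q. partition_on S Q})"
proof -
  have fin: "finite {Q. partition_on S Q}" if "S \<in> Pow A" for S
    using that assms(1) by (auto intro: finitely_many_partition_on finite_subset)
  let ?f = "\<lambda>(S, Q). insert (insert m (A - S)) Q"
  have nm: "m \<notin> q" if "S \<subseteq> A" "partition_on S Q" "q \<in> Q" for S Q q
    using that assms(2) by (auto simp: partition_on_def)
  have "bij_betw ?f (Sigma (Pow A) (\<lambda>S. {Q. partition_on S Q})) {Q. partition_on (insert m A) Q}"
    unfolding bij_betw_def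
  proof
    show "inj_on ?f (Sigma (Pow A) (\<lambda>S. {Q. partition_on S Q}))"
    proof (rule inj_onI, clarify)
      fix S Q S' Q'
      assume *: "S \<subseteq> A" "partition_on S Q" "S' \<subseteq> A" "partition_on S' Q'"
        and eq: "insert (insert m (A - S)) Q = insert (insert m (A - S')) Q'"
      \<comment> \<open>The added block is the only one containing \<open>m\<close>: the blocks
        without \<open>m\<close> give back \<open>Q\<close>, and their union gives back
        \<open>S\<close>.\<close>
      have "Q = {q \<in> insert (insert m (A - S)) Q. m \<notin> q}" using nm[OF *(1,2)] by auto
      moreover have "Q' = {q \<in> insert (insert m (A - S')) Q'. m \<notin> q}"
        using nm[OF *(3,4)] by auto
      ultimately have "Q = Q'" using eq by simp
      with * show "S = S' \<and> Q = Q'" by (simp add: partition_on_def)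
    qed
    show "?f ` Sigma (Pow A) (\<lambda>S. {Q. partition_on S Q}) = {Q. partition_on (insert m A) Q}"
    proof (intro equalityI subsetI)
      fix R assume "R \<in> ?f ` Sigma (Pow A) (\<lambda>S. {Q. partition_on S Q})"
      then obtain S Q where *: "S \<subseteq> A" "partition_on S Q" "R = insert (insert m (A - S)) Q"
        by auto
      have "disjnt (insert m (A - S)) (\<Union>Q)"
        using * assms(2) by (auto simp: disjnt_def partition_on_def)
      moreover have "insert m A - insert m (A - S) = S"
        using * assms(2) by auto
      ultimately show "R \<in> {Q. partition_on (insert m A) Q}"
        using * by (auto simp: partition_on_insert)
    next
      fix R assume "R \<in> {Q. partition_on (insert m A) Q}"
      then have R: "partition_on (insert m A) R" by simp
      then obtain p where p: "p \<in> R" "m \<in> p" by (auto simp: partition_on_def)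
      define Q where "Q = R - {p}"
      have RQ: "R = insert p Q" using p by (auto simp: Q_def)
      have "disjnt p (\<Union>Q)"
        using R p by (auto simp: Q_def partition_on_def disjoint_def disjnt_def)
      with R RQ have "partition_on (insert m A - p) Q" "p \<subseteq> insert m A"
        by (auto simp: partition_on_insert)
      moreover have "insert m (A - (insert m A - p)) = p"
        using p \<open>p \<subseteq> insert m A\<close> by auto
      moreover have "insert m A - p \<subseteq> A" using p by auto
      ultimately show "R \<in> ?f ` Sigma (Pow A) (\<lambda>S. {Q. partition_on S Q})"
        using RQ by (intro image_eqI[where x = "(insert m A - p, Q)"]) auto
    qed
  qed
  from bij_betw_same_card[OF this] show ?thesis
    using assms(1) fin by (simp add: card_SigmaI)
qed

section \<open>Words split at their maximum\<close>

text \<open>The index \<open>S\<close> is the set of letters after \<open>m\<close>. Since the word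
  before \<open>m\<close> is forced by its letters, \<open>S\<close> and the word after
  \<open>m\<close> determine everything. The listing \<open>g\<close> is left open because one
  application needs a decreasing and another an increasing one.\<close>

lemma card_permutations_split:
  assumes "finite A" "m \<notin> A"
    and g: "\<And>T. T \<subseteq> A \<Longrightarrow> set (g T) = T \<and> distinct (g T)"
    and R: "\<And>u v. u @ m # v \<in> permutations_of_set (insert m A) \<Longrightarrow>
              R (u @ m # v) \<longleftrightarrow> u = g (set u) \<and> G v"
  shows "card {w \<in> permutations_of_set (insert m A). R w} =
         (\<Sum>S\<in>Pow A. card {v \<in> permutations_of_set S. G v})"
proof -
  let ?f = "\<lambda>(S, v). g (A - S) @ m # v"
  let ?D = "Sigma (Pow A) (\<lambda>S. {v \<in> permutations_of_set S. G v})"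
  have mg: "m \<notin> set (g (A - S))" for S using g[of "A - S"] assms(2) by auto
  have "bij_betw ?f ?D {w \<in> permutations_of_set (insert m A). R w}"
    unfolding bij_betw_def
  proof
    show "inj_on ?f ?D"
    proof (rule inj_onI, clarify)
      fix S v S' v'
      assume *: "S \<subseteq> A" "v \<in> permutations_of_set S" "S' \<subseteq> A" "v' \<in> permutations_of_set S'"
        and eq: "g (A - S) @ m # v = g (A - S') @ m # v'"
      have "m \<notin> set v" "m \<notin> set v'" using * assms(2) by (auto dest: permutations_of_setD)
      with eq mg have "v = v'" by (metis append_Cons_eq_iff)
      with * show "S = S' \<and> v = v'" by (auto dest: permutations_of_setD)
    qed
    show "?f ` ?D = {w \<in> permutations_of_set (insert m A). R w}"
    proof (intro equalityI subsetI)
      fix w assume "w \<in> ?f ` ?D"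
      then obtain S v where *: "S \<subseteq> A" "v \<in> permutations_of_set S" "G v"
        "w = g (A - S) @ m # v" by auto
      have "w \<in> permutations_of_set (insert m A)"
        using * g[of "A - S"] assms(2) by (auto simp: permutations_of_set_def)
      moreover from this have "R w" using R * g[of "A - S"] by auto
      ultimately show "w \<in> {w \<in> permutations_of_set (insert m A). R w}" by simp
    next
      fix w assume "w \<in> {w \<in> permutations_of_set (insert m A). R w}"
      then have w: "set w = insert m A" "distinct w" "R w"
        by (auto dest: permutations_of_setD)
      then obtain u v where uv: "w = u @ m # v" by (metis insertI1 split_list)
      with w R have "u = g (set u)" "G v" by (auto simp: permutations_of_set_def)
      moreover have "A = set u \<union> set v" "set u \<inter> set v = {}" using uv w assms(2) by auto
      moreover from this have "A - set v = set u" by auto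
      ultimately show "w \<in> ?f ` ?D"
        using w uv by (intro image_eqI[where x = "(set v, v)"]) (auto simp: permutations_of_set_def)
    qed
  qed
  from bij_betw_same_card[OF this] show ?thesis
    using assms(1) by (simp add: card_SigmaI)
qed

text \<open>Avoidance of the vincular pattern 12-3: \<open>sublist\<close> makes the first two
  letters adjacent, \<open>subseq\<close> allows a gap before the third. In words with distinct
  letters both conditions refer to the same position of \<open>b\<close>.\<close>

definition avoids_12_3 :: "nat list \<Rightarrow> bool" where
  "avoids_12_3 w \<longleftrightarrow> (\<forall>a b c. sublist [a, b] w \<longrightarrow> subseq [b, c] w \<longrightarrow> a < b \<longrightarrow> c \<le> b)"

lemma subseq_pair_Cons:
  "subseq [b, c] (x # xs) \<longleftrightarrow> (if b = x then c \<in> set xs else subseq [b, c] xs)"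
  by (simp add: subseq_singleton_left)

lemma sublist_pair_Cons2:
  "sublist [a, b] (x # y # ys) \<longleftrightarrow> a = x \<and> b = y \<or> sublist [a, b] (y # ys)"
  by (auto simp: sublist_Cons_right)

lemma sublist_pair_in_set: "sublist [a, b] w \<Longrightarrow> a \<in> set w \<and> b \<in> set w"
  by (auto dest: set_mono_sublist)

lemma avoids_12_3_Nil [simp]: "avoids_12_3 []"
  by (simp add: avoids_12_3_def)

lemma avoids_12_3_single [simp]: "avoids_12_3 [x]"
  by (auto simp: avoids_12_3_def sublist_Cons_right)

text \<open>The only new adjacent pair is \<open>[x, y]\<close>, and by distinctness the leading
  \<open>x\<close> is not the larger letter of any later ascent.\<close>

lemma avoids_12_3_Cons2:
  assumes "distinct (x # y # w)"
  shows "avoids_12_3 (x # y # w) \<longleftrightarrow> (x < y \<longrightarrow> (\<forall>c\<in>set w. c \<le> y)) \<and> avoids_12_3 (y # w)"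
proof -
  have "subseq [y, c] (x # y # w) \<longleftrightarrow> c \<in> set w" for c
    using assms by (auto simp: subseq_singleton_left)
  moreover have "subseq [b, c] (x # y # w) \<longleftrightarrow> subseq [b, c] (y # w)"
    if "sublist [a, b] (y # w)" for a b c
    using sublist_pair_in_set[OF that] assms by auto
  ultimately show ?thesis
    unfolding avoids_12_3_def sublist_pair_Cons2 by blast
qed

lemma avoids_12_3_max_Cons:
  assumes "distinct (m # v)" "\<And>y. y \<in> set v \<Longrightarrow> y < m"
  shows "avoids_12_3 (m # v) \<longleftrightarrow> avoids_12_3 v"
  using assms by (cases v) (auto simp: avoids_12_3_Cons2 dest: less_asym)

text \<open>Any ascent inside \<open>u\<close> is completed to an occurrence by \<open>m\<close>, so
  \<open>u\<close> must decrease. An ascent ending at \<open>m\<close> is harmless, since nothing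
  larger follows.\<close>

lemma avoids_12_3_split_max:
  assumes "distinct (u @ m # v)" "\<And>y. y \<in> set u \<union> set v \<Longrightarrow> y < m"
  shows "avoids_12_3 (u @ m # v) \<longleftrightarrow> sorted_wrt (>) u \<and> avoids_12_3 v"
  using assms
proof (induction u rule: induct_list012)
  case 1
  then show ?case by (simp add: avoids_12_3_max_Cons)
next
  case (2 x)
  then have "avoids_12_3 (m # v) \<longleftrightarrow> avoids_12_3 v" by (intro avoids_12_3_max_Cons) auto
  moreover have "\<forall>c\<in>set v. c \<le> m" using 2 by (auto intro: less_imp_le)
  ultimately show ?case using 2 by (simp add: avoids_12_3_Cons2)
next
  case (3 x y u)
  have "avoids_12_3 (x # y # u @ m # v) \<longleftrightarrow> \<not> x < y \<and> avoids_12_3 (y # u @ m # v)"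
    using 3(3) 3(4)[of y] by (subst avoids_12_3_Cons2) (auto simp: not_le)
  also have "avoids_12_3 (y # u @ m # v) \<longleftrightarrow> sorted_wrt (>) (y # u) \<and> avoids_12_3 v"
    using 3(2)[simplified] 3(3,4) by auto
  also have "\<not> x < y \<longleftrightarrow> y < x" using 3(3) by auto
  finally show ?case by (auto dest: less_trans)
qed

text \<open>Puts the order condition into the form \<open>u = g (set u)\<close> required by
  \<open>card_permutations_split\<close>.\<close>

lemma sorted_wrt_less_iff_sorted_list_of_set:
  fixes u :: "nat list"
  shows "sorted_wrt (<) u \<longleftrightarrow> u = sorted_list_of_set (set u)"
  by (metis List.finite_set sorted_list_of_set.idem_if_sorted_distinct
      sorted_list_of_set.strict_sorted_key_list_of_set strict_sorted_iff)

lemma sorted_wrt_greater_iff_rev_sorted_list_of_set: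
  fixes u :: "nat list"
  shows "sorted_wrt (>) u \<longleftrightarrow> u = rev (sorted_list_of_set (set u))"
  using sorted_wrt_less_iff_sorted_list_of_set[of "rev u"]
  by (simp add: sorted_wrt_rev rev_swap)

text \<open>Both counts obey the same recurrence: the letters before the maximum decrease, hence are
  fixed by their set, and those after it form a smaller avoider.\<close>

lemma card_avoids_12_3:
  "finite A \<Longrightarrow> card {w \<in> permutations_of_set A. avoids_12_3 w} = card {Q. partition_on A Q}"
proof (induction A rule: finite_psubset_induct)
  case (psubset A)
  show ?case
  proof (cases "A = {}")
    case True
    have "{w \<in> permutations_of_set ({} :: nat set). avoids_12_3 w} = {[]}" by auto
    then show ?thesis by (simp add: True partition_on_empty)
  next
    case False
    define m where "m = Max A"
    define A' where "A' = A - {m}"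
    have A: "A = insert m A'" "m \<notin> A'" "finite A'"
      using Max_in[OF psubset.hyps False] psubset.hyps by (auto simp: m_def A'_def)
    have less: "y < m" if "y \<in> A'" for y
      using that psubset.hyps by (auto simp: m_def A'_def intro: le_neq_trans)
    have "card {w \<in> permutations_of_set A. avoids_12_3 w} =
          (\<Sum>S\<in>Pow A'. card {w \<in> permutations_of_set S. avoids_12_3 w})"
      unfolding A(1)
    proof (rule card_permutations_split[where g = "\<lambda>T. rev (sorted_list_of_set T)"])
      fix u v assume uv: "u @ m # v \<in> permutations_of_set (insert m A')"
      then have d: "distinct (u @ m # v)" "set (u @ m # v) = insert m A'"
        using permutations_of_setD[OF uv] by simp_all
      then have "y < m" if "y \<in> set u \<union> set v" for y
        using that by (intro less) auto
      from avoids_12_3_split_max[OF d(1) this]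
      show "avoids_12_3 (u @ m # v) \<longleftrightarrow>
          u = rev (sorted_list_of_set (set u)) \<and> avoids_12_3 v"
        by (simp only: sorted_wrt_greater_iff_rev_sorted_list_of_set)
    qed (use A finite_subset[OF _ A(3)] in auto)
    also have "\<dots> = (\<Sum>S\<in>Pow A'. card {Q. partition_on S Q})"
      using A by (intro sum.cong refl psubset.IH) auto
    also have "\<dots> = card {Q. partition_on A Q}"
      unfolding A(1) using A by (intro card_partition_on_insert[symmetric]) auto
    finally show ?thesis .
  qed
qed

section \<open>The cycles read off from the left-to-right maxima\<close>

text \<open>This closing arrow of a cycle is the one that later ascends to the head of a
  block.\<close>

lemma cycle_of_list_last: "cycle_of_list (x # xs) (last (x # xs)) = x"
  by (induction xs arbitrary: x) auto

lemma cycle_of_list_eq_iff_sublist: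
  assumes "distinct (x # xs)" "b \<in> set xs"
  shows "cycle_of_list (x # xs) a = b \<longleftrightarrow> sublist [a, b] (x # xs)"
  using assms
proof (induction xs arbitrary: x)
  case (Cons y ws)
  show ?case
  proof (cases "b = y")
    case True
    \<comment> \<open>The shorter cycle fixes \<open>x\<close>, and \<open>transpose x y\<close>
      sends only \<open>x\<close> to \<open>y\<close>; so \<open>a = x\<close> is the only preimage
      of \<open>y\<close>.\<close>
    have "cycle_of_list (y # ws) x = x"
      using Cons.prems by (intro id_outside_supp) auto
    then have "cycle_of_list (y # ws) a = x \<longleftrightarrow> a = x"
      using permutes_inj[OF cycle_permutes[of "y # ws"]] by (metis injD)
    then have "cycle_of_list (x # y # ws) a = y \<longleftrightarrow> a = x"
      using Cons.prems by (auto simp: transpose_eq_iff)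
    moreover have "\<not> sublist [a, y] (y # ws)"
      using Cons.prems by (auto simp: sublist_Cons_right dest: sublist_pair_in_set set_mono_prefix)
    ultimately show ?thesis using True by (simp add: sublist_pair_Cons2 del: cycle_of_list.simps)
  next
    case False
    with Cons.prems have "b \<in> set ws" "b \<noteq> x" by auto
    with False have "cycle_of_list (x # y # ws) a = b \<longleftrightarrow> cycle_of_list (y # ws) a = b"
      by (auto simp: transpose_eq_iff transpose_def)
    with Cons \<open>b \<in> set ws\<close> False show ?thesis
      by (simp add: sublist_pair_Cons2 del: cycle_of_list.simps)
  qed
qed simp

lemma hat_Nil: "hat [] = id"
  by (simp add: hat_def)

lemma hat_Cons:
  "hat (x # xs) =
   cycle_of_list (x # takeWhile (\<lambda>y. y \<le> x) xs) \<circ> hat (dropWhile (\<lambda>y. y \<le> x) xs)"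
  by (simp add: hat_def)

lemma hat_outside: "a \<notin> set p \<Longrightarrow> hat p a = a"
proof (induction p rule: lrmax_blocks.induct)
  case (2 x xs)
  then have "a \<notin> set (takeWhile (\<lambda>y. y \<le> x) xs)" "a \<notin> set (dropWhile (\<lambda>y. y \<le> x) xs)"
    by (auto dest: set_takeWhileD set_dropWhileD)
  with 2 show ?case by (simp add: hat_Cons id_outside_supp)
qed (simp add: hat_Nil)

text \<open>Avoidance of the arrow pattern, stated for arbitrary words so that letters can be
  removed one by one. No membership of \<open>a\<close> is demanded: \<open>hat p\<close> fixes
  everything outside \<open>p\<close>, so \<open>a < b\<close> already makes \<open>a\<close> a
  letter.\<close>

definition arrow_free :: "nat list \<Rightarrow> bool" where
  "arrow_free p \<longleftrightarrow> (\<forall>a b c. a < b \<longrightarrow> hat p a = b \<longrightarrow> subseq [b, c] p \<longrightarrow> c \<le> b)"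

text \<open>The leading maximum makes the whole word a single cycle. A letter with a larger one to
  its right is not \<open>m\<close>, so the arrow into it comes from its left neighbour and the
  pattern becomes 12-3.\<close>

lemma arrow_free_max_Cons:
  assumes "distinct (m # v)" "\<And>y. y \<in> set v \<Longrightarrow> y < m"
  shows "arrow_free (m # v) \<longleftrightarrow> avoids_12_3 v"
proof -
  have "takeWhile (\<lambda>y. y \<le> m) v = v" "dropWhile (\<lambda>y. y \<le> m) v = []"
    using assms(2) by (auto simp: less_imp_le takeWhile_eq_all_conv)
  then have hat: "hat (m # v) = cycle_of_list (m # v)" by (simp only: hat_Cons hat_Nil comp_id)
  have "hat (m # v) a = b \<and> subseq [b, c] (m # v) \<longleftrightarrow>
        sublist [a, b] (m # v) \<and> subseq [b, c] (m # v)" if "b < c" for a b c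
  proof (cases "b \<in> set v")
    case True
    then show ?thesis using assms(1) by (simp add: hat cycle_of_list_eq_iff_sublist)
  next
    case False
    have "\<not> subseq [b, c] (m # v)"
    proof
      assume s: "subseq [b, c] (m # v)"
      from list_emb_set[OF s, of b] False have "b = m" by auto
      with s assms(2) \<open>b < c\<close> show False
        by (auto simp: subseq_singleton_left dest: less_asym)
    qed
    then show ?thesis by simp
  qed
  then have "arrow_free (m # v) \<longleftrightarrow> avoids_12_3 (m # v)"
    unfolding arrow_free_def avoids_12_3_def by (metis not_le)
  with avoids_12_3_max_Cons[OF assms] show ?thesis by simp
qed

text \<open>If the block of \<open>x\<close> has further letters, the last of them is smaller than
  \<open>x\<close> and maps to \<open>x\<close>, which with \<open>y\<close> gives an occurrence. If
  not, \<open>x\<close> is a fixed point and can be removed.\<close>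

lemma arrow_free_nonmax_Cons:
  assumes "distinct (x # xs)" "y \<in> set xs" "x < y"
  shows "arrow_free (x # xs) \<longleftrightarrow> x < hd xs \<and> arrow_free xs"
proof (cases "x < hd xs")
  case True
  obtain z zs where xs: "xs = z # zs" using assms(2) by (cases xs) auto
  with True have "takeWhile (\<lambda>y. y \<le> x) xs = []" "dropWhile (\<lambda>y. y \<le> x) xs = xs" by auto
  then have hat: "hat (x # xs) = hat xs" by (simp add: hat_Cons)
  \<comment> \<open>Injectivity leaves the fixed point \<open>x\<close> no other preimage, so
    \<open>x\<close> is never reached from a smaller letter.\<close>
  have "a = x" if "hat xs a = x" for a
  proof (rule ccontr)
    assume "a \<noteq> x"
    have "x \<notin> set xs" using assms by simp
    have "inj (hat xs)"
    proof (induction xs rule: lrmax_blocks.induct)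
      case (2 x xs)
      show ?case unfolding hat_Cons
        by (intro inj_compose 2 permutes_inj[OF cycle_permutes])
    qed (simp add: hat_Nil)
    with that hat_outside[OF \<open>x \<notin> set xs\<close>] \<open>a \<noteq> x\<close> show False by (metis injD)
  qed
  then have "subseq [b, c] (x # xs) \<longleftrightarrow> subseq [b, c] xs" if "a < b" "hat xs a = b" for a b c
    using that by (metis less_irrefl subseq_pair_Cons)
  with True show ?thesis unfolding arrow_free_def hat by blast
next
  case False
  define tw where "tw = takeWhile (\<lambda>y. y \<le> x) xs"
  define dw where "dw = dropWhile (\<lambda>y. y \<le> x) xs"
  have split: "xs = tw @ dw" by (simp add: tw_def dw_def)
  obtain z zs where xs: "xs = z # zs" using assms(2) by (cases xs) auto
  with False have "tw \<noteq> []" by (simp add: tw_def not_less)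
  define l where "l = last tw"
  have l: "l \<in> set tw" using \<open>tw \<noteq> []\<close> by (simp add: l_def)
  then have "l < x"
    using assms(1) split by (metis distinct.simps(2) le_neq_implies_less set_takeWhileD tw_def)
  \<comment> \<open>The cycle of the first block is applied last in \<open>hat\<close>, so the later
    cycles must be known to fix \<open>l\<close>.\<close>
  have "l \<notin> set dw" using l assms(1) split by auto
  then have "hat (x # xs) l = cycle_of_list (x # tw) (last (x # tw))"
    using \<open>tw \<noteq> []\<close> by (simp add: hat_Cons hat_outside l_def flip: tw_def dw_def)
  then have "hat (x # xs) l = x" by (simp only: cycle_of_list_last)
  moreover have "subseq [x, y] (x # xs)" using assms(2) by (simp add: subseq_singleton_left)
  ultimately have "\<not> arrow_free (x # xs)"
    unfolding arrow_free_def using \<open>l < x\<close> assms(3) by (metis not_le)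
  with False show ?thesis by simp
qed

text \<open>Each letter of \<open>u\<close> has the larger \<open>m\<close> to its right, so it must
  lie below its successor; for the last one the successor is \<open>m\<close> and the condition is
  free.\<close>

lemma arrow_free_split_max:
  assumes "distinct (u @ m # v)" "\<And>y. y \<in> set u \<union> set v \<Longrightarrow> y < m"
  shows "arrow_free (u @ m # v) \<longleftrightarrow> sorted_wrt (<) u \<and> avoids_12_3 v"
  using assms
proof (induction u)
  case Nil
  then show ?case by (simp add: arrow_free_max_Cons)
next
  case (Cons x u)
  then have "arrow_free (x # u @ m # v) \<longleftrightarrow> x < hd (u @ m # v) \<and> arrow_free (u @ m # v)"
    by (intro arrow_free_nonmax_Cons[where y = m]) auto
  also have "arrow_free (u @ m # v) \<longleftrightarrow> sorted_wrt (<) u \<and> avoids_12_3 v"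
    using Cons by auto
  finally show ?case using Cons.prems by (cases u) (auto dest: less_trans)
qed

section \<open>The arrow pattern\<close>

lemma subseq_pair_iff_nth:
  "subseq [b, c] p \<longleftrightarrow> (\<exists>i j. i < j \<and> j < length p \<and> p ! i = b \<and> p ! j = c)"
proof
  show "subseq [b, c] p \<Longrightarrow> \<exists>i j. i < j \<and> j < length p \<and> p ! i = b \<and> p ! j = c"
  proof (induction p)
    case (Cons x p)
    show ?case
    proof (cases "b = x")
      case True
      with Cons.prems obtain j where "j < length p" "p ! j = c"
        by (auto simp: subseq_singleton_left in_set_conv_nth)
      with True show ?thesis by (intro exI[of _ 0] exI[of _ "Suc j"]) simp
    next
      case False
      with Cons obtain i j where "i < j" "j < length p" "p ! i = b" "p ! j = c" by auto
      then show ?thesis by (intro exI[of _ "Suc i"] exI[of _ "Suc j"]) simp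
    qed
  qed simp
next
  assume "\<exists>i j. i < j \<and> j < length p \<and> p ! i = b \<and> p ! j = c"
  then obtain i j where ij: "i < j" "j < length p" "p ! i = b" "p ! j = c" by blast
  then have "p = take i p @ b # drop (Suc i) p" by (auto simp: id_take_nth_drop)
  moreover have "c \<in> set (drop (Suc i) p)"
    using ij by (auto simp: in_set_conv_nth intro!: exI[of _ "j - Suc i"])
  then have "subseq [b, c] (b # drop (Suc i) p)" by (simp add: subseq_singleton_left)
  ultimately show "subseq [b, c] p" by (metis subseq_drop_many)
qed

lemma contains_arrow_iff:
  assumes "p \<in> permutations_of_set {1..n}"
  shows "contains_arrow p ([2, 3], {(1, 2)}) \<longleftrightarrow> \<not> arrow_free p"
proof -
  have "letters ([2, 3], {(1, 2)}) = {1, 2, 3}" by (auto simp: letters_def)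
  then have size: "pattern_size ([2, 3], {(1, 2)}) = 3" by (simp add: pattern_size_def)
  have I3: "{1..3::nat} = {1, 2, 3}" and I2: "{..<2::nat} = {0, 1}" by auto
  have p: "set p = {1..n}" "length p = n"
    using assms by (auto dest: permutations_of_setD length_finite_permutations_of_set)
  show ?thesis
  proof
    assume "contains_arrow p ([2, 3], {(1, 2)})"
    then obtain x t :: "nat \<Rightarrow> nat" where x: "strict_mono_on {1..3} x"
      and t: "strict_mono_on {..<2} t" "t ` {..<2} \<subseteq> {..<length p}"
      and pt: "\<forall>j<2. p ! t j = x ([2, 3] ! j)" and hat: "hat p (x 1) = x 2"
      unfolding contains_arrow_def size by (auto simp: numeral_2_eq_2)
    have nu: "p ! t 0 = x 2" "p ! t 1 = x 3"
      using pt[rule_format, of 0] pt[rule_format, of 1] by simp_all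
    have "x 1 < x 2" "x 2 < x 3" using x by (auto simp: strict_mono_on_def)
    moreover have "t 0 < t 1" "t 1 < length p"
      using t by (auto simp: strict_mono_on_def image_subset_iff)
    then have "subseq [x 2, x 3] p" using nu by (auto simp: subseq_pair_iff_nth)
    ultimately show "\<not> arrow_free p" using hat unfolding arrow_free_def by (metis not_le)
  next
    assume "\<not> arrow_free p"
    then obtain a b c i j where abc: "a < b" "b < c" "hat p a = b"
      and ij: "i < j" "j < length p" "p ! i = b" "p ! j = c"
      unfolding arrow_free_def subseq_pair_iff_nth by (auto simp: not_le)
    \<comment> \<open>An ascending arrow moves \<open>a\<close>, which is therefore a letter and
      lies in the required range.\<close>
    have "a \<in> set p" using abc hat_outside[of a p] by auto
    moreover have "b \<in> set p" "c \<in> set p" using ij by auto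
    ultimately have range: "{a, b, c} \<subseteq> {1..length p}" using p by auto
    \<comment> \<open>The enumeration of \<open>{a, b, c}\<close> and the positions of
      \<open>b\<close> and \<open>c\<close>; values outside \<open>{1, 2, 3}\<close> and
      \<open>{0, 1}\<close> are arbitrary.\<close>
    define x where "x = (\<lambda>k :: nat. if k = 1 then a else if k = 2 then b else c)"
    define t where "t = (\<lambda>k :: nat. if k = 0 then i else j)"
    have "strict_mono_on {1..3} x"
      using abc unfolding I3 by (auto simp: strict_mono_on_def x_def)
    moreover have "x ` {1..3} \<subseteq> {1..length p}"
      using range unfolding I3 by (auto simp: x_def)
    moreover have "strict_mono_on {..<2} t" "t ` {..<2} \<subseteq> {..<length p}"
      using ij unfolding I2 by (auto simp: strict_mono_on_def t_def)
    moreover have "\<forall>k<2. p ! t k = x ([2, 3] ! k)"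
      using ij by (auto simp: less_2_cases_iff t_def x_def)
    moreover have "hat p (x 1) = x 2" using abc by (simp add: x_def)
    ultimately show "contains_arrow p ([2, 3], {(1, 2)})"
      unfolding contains_arrow_def size prod.case
      by - (rule exI[of _ x], rule exI[of _ t], auto simp: numeral_2_eq_2)
  qed
qed

theorem theorem5p2:
  fixes n :: nat
  assumes "n \<ge> 1"
  shows "card (avoiders n ([2, 3], {(1, 2)})) = bell n"
proof -
  \<comment> \<open>Here \<open>n \<ge> 1\<close> provides the maximal letter at which the words are
    split.\<close>
  have n: "{1..n} = insert n {1..<n}" using assms by auto
  have "card (avoiders n ([2, 3], {(1, 2)})) =
        card {p \<in> permutations_of_set (insert n {1..<n}). arrow_free p}"
    unfolding avoiders_def n[symmetric] by (metis contains_arrow_iff)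
  also have "\<dots> = (\<Sum>S\<in>Pow {1..<n}. card {w \<in> permutations_of_set S. avoids_12_3 w})"
  \<comment> \<open>In contrast to the count for 12-3, the letters before the maximum
    increase.\<close>
  proof (rule card_permutations_split[where g = sorted_list_of_set])
    fix u v assume uv: "u @ n # v \<in> permutations_of_set (insert n {1..<n})"
    then have d: "distinct (u @ n # v)" "set (u @ n # v) = insert n {1..<n}"
      using permutations_of_setD[OF uv] by simp_all
    then have "y < n" if "y \<in> set u \<union> set v" for y
      using that by (auto simp: insert_eq_iff)
    from arrow_free_split_max[OF d(1) this]
    show "arrow_free (u @ n # v) \<longleftrightarrow> u = sorted_list_of_set (set u) \<and> avoids_12_3 v"
      by (simp only: sorted_wrt_less_iff_sorted_list_of_set)
  qed (auto dest: finite_subset)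
  also have "\<dots> = (\<Sum>S\<in>Pow {1..<n}. card {Q. partition_on S Q})"
    by (intro sum.cong refl card_avoids_12_3) (auto dest: finite_subset)
  also have "\<dots> = bell n"
    unfolding bell_def n by (rule card_partition_on_insert[symmetric]) auto
  finally show ?thesis .
qed

end
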